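(* Let $a,b$ be integers with $2\le a\le b$, and put $$s(a,b)=a-\mathbf 1_{\{a\text{ is odd and }b\text{ is even}\}}.$$ Then $$M_-(P_a\square P_b)=s(a,b)\qquad\text{and}\qquad \operatorname{mr}^-(P_a\square P_b)=ab-s(a,b).$$
   Context: All graphs are finite and simple. $P_n$ is the path on $n$ vertices. $\mathbf 1_{\mathcal P}$ equals $1$ if property $\mathcal P$ holds and $0$ otherwise. The Cartesian product $G\square H$ has vertex set $V(G)\times V(H)$, with $(u,x)$ adjacent to $(v,y)$ iff either $u=v$ and $xy\in E(H)$, or $x=y$ and $uv\in E(G)$. For a graph $G$ with vertex set $\{1,\ldots,n\}$, $\mathcal S_-(G)$ is the set of real $n\times n$ matrices $A=[a_{ij}]$ with $A^T=-A$ and, for $i\ne j$, $a_{ij}\neq0$ if and only if $ij\in E(G)$. Define $M_-(G)=\max_{A\in\mathcal S_-(G)}\operatorname{nullity}A$ and the minimum skew rank $\operatorname{mr}^-(G)=\min_{A\in\mathcal S_-(G)}\operatorname{rank}A=n-M_-(G)$. *)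

theory Defs
  imports
    "Graph_Theory.Pair_Digraph"
    "Jordan_Normal_Form.DL_Rank"
    "Jordan_Normal_Form.Matrix_Kernel"
begin

text \<open>
  A finite simple graph is a \<^locale>\<open>pair_graph\<close>: finite, symmetric, loop-free. An undirected edge
  \<open>uv\<close> is represented by the two arcs \<open>(u, v)\<close> and \<open>(v, u)\<close>.
\<close>

definition path_graph :: "nat \<Rightarrow> nat pair_pre_digraph" where
  "path_graph n =
    \<lparr> pverts = {1..n},
      parcs = {(i, j). i \<in> {1..n} \<and> j \<in> {1..n} \<and> (j = i + 1 \<or> i = j + 1)} \<rparr>"

definition cartesian_product ::
  "'a pair_pre_digraph \<Rightarrow> 'b pair_pre_digraph \<Rightarrow> ('a \<times> 'b) pair_pre_digraph"
  (infixr \<open>\<box>\<close> 70) where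
  "G \<box> H =
    \<lparr> pverts = pverts G \<times> pverts H,
      parcs = {((u, x), (v, y)). (u, x) \<in> pverts G \<times> pverts H \<and> (v, y) \<in> pverts G \<times> pverts H \<and>
        (u = v \<and> (x, y) \<in> parcs H \<or> x = y \<and> (u, v) \<in> parcs G)} \<rparr>"

text \<open>
  A numbering turns \<open>G\<close> into a graph on the index set of an \<open>n \<times> n\<close> matrix. Matrix indices start at
  \<open>0\<close>, so row and column \<open>i\<close> belong to the vertex \<open>f i\<close> with \<open>i < n\<close>.
\<close>

definition vertex_numbering :: "(nat \<Rightarrow> 'v) \<Rightarrow> 'v pair_pre_digraph \<Rightarrow> bool" where
  "vertex_numbering f G \<longleftrightarrow> bij_betw f {..<card (pverts G)} (pverts G)"

definition S_minus :: "(nat \<Rightarrow> 'v) \<Rightarrow> 'v pair_pre_digraph \<Rightarrow> real mat set" where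
  "S_minus f G =
    {A \<in> carrier_mat (card (pverts G)) (card (pverts G)).
      transpose_mat A = - A \<and>
      (\<forall>i < card (pverts G). \<forall>j < card (pverts G).
        i \<noteq> j \<longrightarrow> (A $$ (i, j) \<noteq> 0 \<longleftrightarrow> (f i, f j) \<in> parcs G))}"

definition mat_rank :: "real mat \<Rightarrow> nat" where
  "mat_rank A = vec_space.rank (dim_row A) A"

definition M_minus :: "(nat \<Rightarrow> 'v) \<Rightarrow> 'v pair_pre_digraph \<Rightarrow> nat" where
  "M_minus f G = Max (kernel_dim ` S_minus f G)"

definition mr_minus :: "(nat \<Rightarrow> 'v) \<Rightarrow> 'v pair_pre_digraph \<Rightarrow> nat" where
  "mr_minus f G = Min (mat_rank ` S_minus f G)"

definition s_grid :: "nat \<Rightarrow> nat \<Rightarrow> nat" where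
  "s_grid a b = a - of_bool (odd a \<and> even b)"


text \<open>
  The graphs are simple, numberings exist, and the maximum and the minimum above range over finite
  nonempty sets.
\<close>

lemma pair_graph_path_graph: "pair_graph (path_graph n)"
proof -
  have "parcs (path_graph n) \<subseteq> {1..n} \<times> {1..n}"
    by (auto simp: path_graph_def)
  then have "finite (parcs (path_graph n))"
    by (rule finite_subset) simp
  then show ?thesis
    by unfold_locales (auto simp: path_graph_def symmetric_def intro!: symI)
qed

lemma pair_graph_cartesian_product:
  assumes "pair_graph G" and "pair_graph H"
  shows "pair_graph (G \<box> H)"
proof -
  interpret G: pair_graph G by fact
  interpret H: pair_graph H by fact
  have "parcs (G \<box> H) \<subseteq> (pverts G \<times> pverts H) \<times> (pverts G \<times> pverts H)"
    by (auto simp: cartesian_product_def)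
  then have "finite (parcs (G \<box> H))"
    by (rule finite_subset) (simp add: G.pair_finite_verts H.pair_finite_verts)
  moreover have "(v, u) \<in> parcs G" if "(u, v) \<in> parcs G" for u v
    using G.pair_sym_arcs that by (auto simp: symmetric_def dest: symD)
  moreover have "(y, x) \<in> parcs H" if "(x, y) \<in> parcs H" for x y
    using H.pair_sym_arcs that by (auto simp: symmetric_def dest: symD)
  ultimately show ?thesis
    using G.pair_finite_verts H.pair_finite_verts
    by unfold_locales
      (auto simp: cartesian_product_def symmetric_def intro!: symI
        dest: G.pair_no_loops H.pair_no_loops)
qed

lemma vertex_numbering_exists:
  assumes "pair_graph G"
  shows "\<exists>f. vertex_numbering f G"
proof -
  interpret G: pair_graph G by fact
  show ?thesis
    using ex_bij_betw_nat_finite[OF G.pair_finite_verts]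
    by (auto simp: vertex_numbering_def atLeast0LessThan)
qed

lemma S_minus_nonempty:
  assumes "pair_graph G"
  shows "S_minus f G \<noteq> {}"
proof -
  interpret G: pair_graph G by fact
  define n where "n = card (pverts G)"
  define A :: "real mat" where
    "A = mat n n (\<lambda>(i, j). if (f i, f j) \<in> parcs G then (if i < j then 1 else - 1) else 0)"
  have "(v, u) \<in> parcs G \<longleftrightarrow> (u, v) \<in> parcs G" for u v
    using G.pair_sym_arcs by (auto simp: symmetric_def dest: symD)
  moreover have "(u, u) \<notin> parcs G" for u
    using G.pair_no_loops[of "(u, u)"] by auto
  ultimately have "transpose_mat A = - A"
    by (intro eq_matI) (auto simp: A_def not_less le_less)
  then have "A \<in> S_minus f G"
    by (auto simp: S_minus_def A_def n_def)
  then show ?thesis by blast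
qed

lemma finite_nullities: "finite (kernel_dim ` S_minus f G)"
proof (rule finite_subset)
  show "kernel_dim ` S_minus f G \<subseteq> {..card (pverts G)}"
    by (auto simp: S_minus_def kernel_dim_code)
qed simp

lemma finite_ranks: "finite (mat_rank ` S_minus f G)"
proof (rule finite_subset)
  show "mat_rank ` S_minus f G \<subseteq> {..card (pverts G)}"
    by (auto simp: S_minus_def mat_rank_def intro: vec_space.rank_le_nc)
qed simp

end

theory Submission
  imports Defs
begin

text \<open>
  Call the vertices of the \<open>a \<times> b\<close> grid with a fixed second coordinate a column. In a kernel vector of
  a matrix of the grid, the first column, with its \<open>a\<close> entries, determines the second one, these two
  determine the third, and so on; hence the nullity is at most \<open>a\<close> (\<open>card_null_family_le\<close>). The same
  count applies to vectors that satisfy all equations except those of the last column. So if the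
  nullity were exactly \<open>a\<close>, such vectors would automatically lie in the kernel. When \<open>a\<close> is odd and \<open>b\<close>
  is even, the principal submatrix on the first \<open>b - 1\<close> columns is skew-symmetric of odd order,
  therefore singular; a null vector of it, extended by zero, would be a nonzero kernel vector that
  vanishes on the last column. Forcing from the last column backwards excludes it
  (\<open>no_null_family_odd_even\<close>).

  For the lower bound, take symmetric weighted adjacency matrices \<open>X\<close> of \<open>P\<^sub>a\<close> and \<open>Y\<close> of \<open>P\<^sub>b\<close> with
  simple spectra. If \<open>X u = x u\<close> and \<open>Y v = x v\<close>, then \<open>u \<otimes> v\<close> is annihilated by
  \<open>X \<otimes> 1 - 1 \<otimes> Y\<close>, so the nullity of this matrix is at least the number of common eigenvalues.
  The grid is bipartite, and a change of signs turns this symmetric matrix into a skew-symmetric one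
  of the same nullity (\<open>grid_kernel_vector\<close>). The spectrum of a weighted path of order \<open>n\<close> can be any
  set of \<open>n\<close> reals that is symmetric about \<open>0\<close>: the weights are the recurrence coefficients of the
  polynomials orthogonal with respect to the counting measure on this set
  (\<open>weighted_path_with_spectrum\<close>). Choosing the \<open>n\<close> integers closest to \<open>0\<close>, without \<open>0\<close> itself if
  \<open>n\<close> is even, makes the spectra for \<open>a\<close> and \<open>b\<close> share exactly \<open>s(a, b)\<close> elements.
\<close>

section \<open>Nullity and families of null vectors\<close>

text \<open>
  Families indexed by numbers rather than sets of vectors, so that repeated members count as dependent
  and a family can be extended by \<open>w(k := y)\<close>.
\<close>

definition independent_on :: "'v set \<Rightarrow> nat \<Rightarrow> (nat \<Rightarrow> 'v \<Rightarrow> real) \<Rightarrow> bool" where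
  "independent_on V k w \<longleftrightarrow>
    (\<forall>c. (\<forall>p\<in>V. (\<Sum>l<k. c l * w l p) = 0) \<longrightarrow> (\<forall>l<k. c l = 0))"

lemma rank_plus_nullity:
  assumes A: "A \<in> carrier_mat n m"
  shows "mat_rank A + kernel_dim A = m"
proof -
  interpret K: kernel n m A by unfold_locales (rule A)
  interpret N: vec_space "TYPE(real)" n .
  interpret T: linear_map class_ring K.NC.V N.V "\<lambda>v. A *\<^sub>v v"
    apply unfold_locales
    using A by (auto simp: LinearCombinations.module_hom_def mult_add_distrib_mat_vec mult_mat_vec)
  have ker: "T.kerT = mat_kernel A"
    using A by (auto simp: T.ker_def mat_kernel_def)
  have "T.imT = N.col_space A"
    using A by (auto simp: T.im_def N.col_space_eq[OF A])
  then have im: "T.imT = N.span (set (cols A))"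
    by (simp add: N.col_space_def)
  from T.rank_nullity[OF K.NC.fin_dim] show ?thesis
    using A by (simp add: ker im mat_rank_def N.rank_def K.NC.dim_is_n)
qed

text \<open>
  The bridge between the dimension of the matrix kernel and functions on the vertex set: \<open>g\<close> is the
  matrix with its rows and columns renamed to vertices, so that arguments about the grid can use
  coordinates in place of the numbering.
\<close>

lemma nullity_ge_iff:
  fixes A :: "real mat"
  assumes A: "A \<in> carrier_mat n n" and f: "bij_betw f {..<n} V"
    and g: "\<And>i j. i < n \<Longrightarrow> j < n \<Longrightarrow> g (f i) (f j) = A $$ (i, j)"
  shows "k \<le> kernel_dim A \<longleftrightarrow>
    (\<exists>w. (\<forall>l<k. \<forall>p\<in>V. (\<Sum>q\<in>V. g p q * w l q) = 0) \<and> independent_on V k w)"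
proof
  interpret K: kernel n n A by unfold_locales (rule A)
  have V: "V = f ` {..<n}" and inj: "inj_on f {..<n}"
    using f by (auto simp: bij_betw_def)
  have sum_V: "(\<Sum>q\<in>V. h q) = (\<Sum>j<n. h (f j))" for h :: "'a \<Rightarrow> real"
    using sum.reindex_bij_betw[OF f, of h] by simp
  have prod: "(\<Sum>q\<in>V. g (f i) q * x q) = (A *\<^sub>v vec n (\<lambda>j. x (f j))) $ i" if "i < n" for i x
    using that A g by (simp add: sum_V scalar_prod_def atLeast0LessThan)
  {
    assume k: "k \<le> kernel_dim A"
    obtain B where B: "finite B" "K.basis B" using kernel_basis_exists[OF A] by blast
    then have card: "kernel_dim A = card B" by (simp add: K.Ker.dim_basis)
    have BK: "B \<subseteq> mat_kernel A" and indep: "\<not> K.lin_dep B"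
      using B by (auto simp: K.Ker.basis_def)
    obtain S where S: "S \<subseteq> B" "card S = k"
      using k card obtain_subset_with_card_n by metis
    have "finite S" using S B finite_subset by blast
    then obtain b where b: "bij_betw b {..<k} S"
      using ex_bij_betw_nat_finite[of S] S by (auto simp: atLeast0LessThan)
    define w where "w l p = b l $ the_inv_into {..<n} f p" for l p
    have w: "w l (f i) = b l $ i" if "i < n" for l i
      using that by (simp add: w_def the_inv_into_f_f[OF inj])
    have bK: "b l \<in> mat_kernel A" if "l < k" for l
      using that b S BK by (auto simp: bij_betw_def)
    have bw: "vec n (\<lambda>j. w l (f j)) = b l" if "l < k" for l
      using mat_kernelD(1)[OF A bK[OF that]] w by (intro eq_vecI) auto
    have "\<forall>l<k. \<forall>p\<in>V. (\<Sum>q\<in>V. g p q * w l q) = 0"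
    proof (intro allI impI ballI)
      fix l p assume l: "l < k" and "p \<in> V"
      then obtain i where i: "i < n" "p = f i" by (auto simp: V)
      show "(\<Sum>q\<in>V. g p q * w l q) = 0"
        using mat_kernelD(2)[OF A bK[OF l]] i l by (simp add: prod bw del: index_mult_mat_vec)
    qed
    moreover have "independent_on V k w"
      unfolding independent_on_def
    proof (intro allI impI)
      fix c l assume c: "\<forall>p\<in>V. (\<Sum>l<k. c l * w l p) = 0" and l: "l < k"
      define a where "a v = c (the_inv_into {..<k} b v)" for v
      have a: "a (b l) = c l" if "l < k" for l
        using that b by (simp add: a_def bij_betw_def the_inv_into_f_f)
      have SK: "S \<subseteq> mat_kernel A" using S BK by blast
      have "K.lincomb a S = 0\<^sub>v n"
      proof (rule eq_vecI)
        have "K.lincomb a S = K.NC.lincomb a S" by (rule K.lincomb_same[OF SK])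
        then show "dim_vec (K.lincomb a S) = dim_vec (0\<^sub>v n)"
          using K.NC.lincomb_dim[OF \<open>finite S\<close>] SK mat_kernel_carrier[OF A] by simp
        fix i assume "i < dim_vec (0\<^sub>v n :: real vec)"
        then have i: "i < n" by simp
        have "K.lincomb a S $ i = (\<Sum>x\<in>S. a x * x $ i)"
          by (rule K.lincomb_index[OF i SK])
        also have "\<dots> = (\<Sum>l<k. a (b l) * b l $ i)"
          using sum.reindex_bij_betw[OF b, of "\<lambda>x. a x * x $ i"] by simp
        also have "\<dots> = (\<Sum>l<k. c l * w l (f i))" using i by (simp add: a w)
        also have "\<dots> = 0" using c i V by simp
        finally show "K.lincomb a S $ i = 0\<^sub>v n $ i" using i by simp
      qed
      then have "a \<in> S \<rightarrow> {0}"
        using K.Ker.not_lindepD[OF indep \<open>finite S\<close> S(1), of a] by simp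
      then have "a (b l) = 0" using b l by (auto simp: bij_betw_def)
      then show "c l = 0" using a l by simp
    qed
    ultimately show "\<exists>w. (\<forall>l<k. \<forall>p\<in>V. (\<Sum>q\<in>V. g p q * w l q) = 0) \<and> independent_on V k w"
      by blast
  next
    assume "\<exists>w. (\<forall>l<k. \<forall>p\<in>V. (\<Sum>q\<in>V. g p q * w l q) = 0) \<and> independent_on V k w"
    then obtain w where w: "\<And>l p. l < k \<Longrightarrow> p \<in> V \<Longrightarrow> (\<Sum>q\<in>V. g p q * w l q) = 0"
      and indep: "independent_on V k w" by blast
    define b where "b l = vec n (\<lambda>j. w l (f j))" for l
    have bK: "b l \<in> mat_kernel A" if "l < k" for l
    proof (rule mat_kernelI[OF A])
      show "A *\<^sub>v b l = 0\<^sub>v n"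
        using A that w by (intro eq_vecI) (auto simp: b_def prod[symmetric] V simp del: index_mult_mat_vec)
    qed (simp add: b_def)
    have coord: "c l = 0" if "\<And>i. i < n \<Longrightarrow> (\<Sum>l<k. c l * b l $ i) = 0" "l < k" for c l
      using indep that unfolding independent_on_def V by (simp add: b_def)
    have inj_b: "inj_on b {..<k}"
    proof (rule inj_onI, rule ccontr)
      fix l m assume lm: "l \<in> {..<k}" "m \<in> {..<k}" "b l = b m" "l \<noteq> m"
      have "(of_bool (l = l) - of_bool (l = m) :: real) = 0"
      proof (rule coord[of "\<lambda>j. of_bool (j = l) - of_bool (j = m)"])
        fix i assume "i < n"
        have "(\<Sum>j<k. (of_bool (j = l) - of_bool (j = m)) * b j $ i)
          = (\<Sum>j<k. of_bool (j = l) * b j $ i) - (\<Sum>j<k. of_bool (j = m) * b j $ i)"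
          by (simp add: sum_subtractf left_diff_distrib)
        also have "\<dots> = b l $ i - b m $ i"
          using lm by (simp add: of_bool_def if_distrib[of "\<lambda>x. x * _"] cong: if_cong)
        finally show "(\<Sum>j<k. (of_bool (j = l) - of_bool (j = m)) * b j $ i) = 0" using lm by simp
      qed (use lm in auto)
      then show False using lm by simp
    qed
    define S where "S = b ` {..<k}"
    have S: "finite S" "card S = k" "S \<subseteq> mat_kernel A"
      using inj_b bK by (auto simp: S_def card_image)
    have "\<not> K.lin_dep S"
    proof
      assume "K.lin_dep S"
      then obtain a v where a: "K.lincomb a S = 0\<^sub>v n" "v \<in> S" "a v \<noteq> 0"
        using K.Ker.finite_lin_dep[OF S(1)] S(3) by auto
      obtain l where l: "l < k" "v = b l" using a by (auto simp: S_def)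
      have "a (b l) = 0"
      proof (rule coord[of "\<lambda>l. a (b l)"])
        fix i assume i: "i < n"
        have "(\<Sum>l<k. a (b l) * b l $ i) = (\<Sum>x\<in>S. a x * x $ i)"
          unfolding S_def by (simp add: sum.reindex[OF inj_b])
        also have "\<dots> = K.lincomb a S $ i" by (rule K.lincomb_index[OF i S(3), symmetric])
        finally show "(\<Sum>l<k. a (b l) * b l $ i) = 0" using a i by simp
      qed (rule l)
      then show False using a l by simp
    qed
    moreover have "K.Ker.fin_dim"
      using kernel_basis_exists[OF A] by (auto simp: K.Ker.fin_dim_def K.Ker.basis_def)
    ultimately have "card S \<le> K.dim"
      using K.Ker.li_le_dim(2)[of S] S by simp
    then show "k \<le> kernel_dim A" using S by simp
  }
qed

text \<open>
  A system with fewer equations than unknowns, completed by zero rows to a square one, has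
  determinant \<open>0\<close>.
\<close>

lemma underdetermined_system:
  fixes w :: "nat \<Rightarrow> 'v \<Rightarrow> real"
  assumes "finite I" and "card I < k"
  obtains c where "\<exists>l<k. c l \<noteq> 0" and "\<And>p. p \<in> I \<Longrightarrow> (\<Sum>l<k. c l * w l p) = 0"
proof -
  obtain h where h: "bij_betw h {0..<card I} I"
    using ex_bij_betw_nat_finite[OF assms(1)] by blast
  define row where "row i = (if i < card I then vec k (\<lambda>l. w l (h i)) else 0\<^sub>v k)" for i
  define M where "M = mat\<^sub>r k k (\<lambda>i. if i = card I then 0\<^sub>v k else row i)"
  have M: "M \<in> carrier_mat k k" by (simp add: M_def)
  have "det M = 0"
    unfolding M_def using assms(2) by (intro det_row_0) (auto simp: row_def)
  then obtain v where v: "v \<in> carrier_vec k" "v \<noteq> 0\<^sub>v k" "M *\<^sub>v v = 0\<^sub>v k"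
    using det_0_iff_vec_prod_zero[OF M] by blast
  show thesis
  proof
    show "\<exists>l<k. v $ l \<noteq> 0"
      using v(1,2) by (metis eq_vecI carrier_vecD index_zero_vec)
    fix p assume "p \<in> I"
    then obtain i where i: "i < card I" "h i = p"
      using h by (metis atLeastLessThan_iff bij_betw_iff_bijections)
    have "(M *\<^sub>v v) $ i = 0" using v(3) i assms(2) by simp
    then show "(\<Sum>l<k. v $ l * w l p) = 0"
      using i assms(2) v(1)
      by (simp add: M_def row_def scalar_prod_def mult.commute atLeast0LessThan)
  qed
qed

lemma independent_card_le:
  assumes fin: "finite I" and IV: "I \<subseteq> V"
    and indep: "independent_on V k w"
    and determined: "\<And>c. (\<And>p. p \<in> I \<Longrightarrow> (\<Sum>l<k. c l * w l p) = 0) \<Longrightarrow>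
      \<forall>p\<in>V. (\<Sum>l<k. c l * w l p) = 0"
  shows "k \<le> card I"
proof (rule ccontr)
  assume "\<not> k \<le> card I"
  then obtain c where c: "\<exists>l<k. c l \<noteq> 0" "\<And>p. p \<in> I \<Longrightarrow> (\<Sum>l<k. c l * w l p) = 0"
    using underdetermined_system[OF fin, of k w] by auto
  have "\<forall>p\<in>V. (\<Sum>l<k. c l * w l p) = 0" using c(2) by (rule determined)
  then show False using indep c(1) by (auto simp: independent_on_def)
qed

section \<open>Zero forcing and odd skew-symmetric matrices\<close>

text \<open>
  The propagation step of zero forcing: the equation at \<open>p\<close> involves \<open>q\<close> and otherwise only vertices
  of smaller level, at which \<open>x\<close> is already known to vanish.
\<close>

lemma zero_forcing:
  fixes g :: "'v \<Rightarrow> 'v \<Rightarrow> real" and level :: "'v \<Rightarrow> nat"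
  assumes fin: "finite V"
    and force: "\<And>q. q \<in> V \<Longrightarrow> level q > 0 \<Longrightarrow> \<exists>p\<in>V. P p \<and> g p q \<noteq> 0 \<and>
      (\<forall>r\<in>V. r \<noteq> q \<longrightarrow> g p r \<noteq> 0 \<longrightarrow> level r < level q)"
    and row: "\<And>p. p \<in> V \<Longrightarrow> P p \<Longrightarrow> (\<Sum>q\<in>V. g p q * x q) = 0"
    and base: "\<And>q. q \<in> V \<Longrightarrow> level q = 0 \<Longrightarrow> x q = 0"
    and q: "q \<in> V"
  shows "x q = 0"
  using q
proof (induction "level q" arbitrary: q rule: less_induct)
  case less
  show ?case
  proof (cases "level q = 0")
    case False
    then obtain p where p: "p \<in> V" "P p" "g p q \<noteq> 0"
      "\<forall>r\<in>V. r \<noteq> q \<longrightarrow> g p r \<noteq> 0 \<longrightarrow> level r < level q"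
      using force[OF less.prems] by auto
    have "0 = (\<Sum>r\<in>V. g p r * x r)" using row p by simp
    also have "\<dots> = g p q * x q + (\<Sum>r\<in>V - {q}. g p r * x r)"
      using fin less.prems by (rule sum.remove)
    also have "(\<Sum>r\<in>V - {q}. g p r * x r) = 0"
      using p(4) less.hyps by (intro sum.neutral) fastforce
    finally show ?thesis using p(3) by simp
  qed (use base less.prems in blast)
qed

text \<open>
  For odd order \<open>n\<close>, \<open>det M = det M\<^sup>T = det (- M) = (- 1) ^ n * det M = - det M\<close>.
\<close>

lemma odd_skew_singular:
  fixes g :: "'v \<Rightarrow> 'v \<Rightarrow> real"
  assumes odd: "odd (card R)"
    and skew: "\<And>p q. p \<in> R \<Longrightarrow> q \<in> R \<Longrightarrow> g q p = - g p q"
  obtains x where "\<exists>p\<in>R. x p \<noteq> 0" and "\<And>p. p \<in> R \<Longrightarrow> (\<Sum>q\<in>R. g p q * x q) = 0"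
proof -
  define n where "n = card R"
  have "finite R" using odd by (metis card.infinite even_zero)
  then obtain h where h: "bij_betw h {..<n} R"
    using ex_bij_betw_nat_finite[of R] by (auto simp: n_def atLeast0LessThan)
  have hR: "h i \<in> R" if "i < n" for i using h that by (auto simp: bij_betw_def)
  define M where "M = mat n n (\<lambda>(i, j). g (h i) (h j))"
  have M: "M \<in> carrier_mat n n" by (simp add: M_def)
  have "transpose_mat M = (- 1) \<cdot>\<^sub>m M"
  proof (rule eq_matI)
    fix i j assume "i < dim_row ((- 1) \<cdot>\<^sub>m M)" and "j < dim_col ((- 1) \<cdot>\<^sub>m M)"
    then have ij: "i < n" "j < n" by (simp_all add: M_def)
    show "transpose_mat M $$ (i, j) = ((- 1) \<cdot>\<^sub>m M) $$ (i, j)"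
      using ij skew[OF hR[OF ij(1)] hR[OF ij(2)]] by (simp add: M_def)
  qed (simp_all add: M_def)
  then have "det M = (- 1) ^ n * det M"
    using det_transpose[OF M] det_smult[of "- 1" M] M by simp
  then have "det M = 0" using odd by (simp add: n_def)
  then obtain v where v: "v \<in> carrier_vec n" "v \<noteq> 0\<^sub>v n" "M *\<^sub>v v = 0\<^sub>v n"
    using det_0_iff_vec_prod_zero[OF M] by blast
  define x where "x p = v $ the_inv_into {..<n} h p" for p
  have x: "x (h i) = v $ i" if "i < n" for i
    using that h by (simp add: x_def bij_betw_def the_inv_into_f_f)
  show thesis
  proof
    obtain i where "i < n" "v $ i \<noteq> 0"
      using v(1,2) by (metis eq_vecI carrier_vecD index_zero_vec)
    then show "\<exists>p\<in>R. x p \<noteq> 0" using x hR by metis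
    fix p assume "p \<in> R"
    then obtain i where i: "i < n" "p = h i" using h by (auto simp: bij_betw_def)
    have "(\<Sum>q\<in>R. g p q * x q) = (\<Sum>j<n. g p (h j) * x (h j))"
      using sum.reindex_bij_betw[OF h, of "\<lambda>q. g p q * x q"] by simp
    also have "\<dots> = (M *\<^sub>v v) $ i"
      using i v(1) by (simp add: M_def x scalar_prod_def atLeast0LessThan)
    finally show "(\<Sum>q\<in>R. g p q * x q) = 0" using v(3) i by simp
  qed
qed

section \<open>Weighted paths with prescribed symmetric spectrum\<close>

definition discrete_inner :: "real set \<Rightarrow> real poly \<Rightarrow> real poly \<Rightarrow> real" where
  "discrete_inner S p q = (\<Sum>x\<in>S. poly p x * poly q x)"

text \<open>
  The monic orthogonal polynomials for \<open>discrete_inner S\<close>. The general three-term recurrence has a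
  further term \<open>\<langle>X p, p\<rangle> / \<langle>p, p\<rangle> * p\<close>, which is \<open>0\<close> because \<open>S\<close> will be symmetric about \<open>0\<close>; this is
  why the resulting Jacobi matrix has zero diagonal and belongs to a path without loops.
\<close>

fun discrete_orthopoly :: "real set \<Rightarrow> nat \<Rightarrow> real poly" where
  "discrete_orthopoly S 0 = 1"
| "discrete_orthopoly S (Suc 0) = [:0, 1:]"
| "discrete_orthopoly S (Suc (Suc k)) =
    [:0, 1:] * discrete_orthopoly S (Suc k) -
    Polynomial.smult
      (discrete_inner S (discrete_orthopoly S (Suc k)) (discrete_orthopoly S (Suc k)) /
        discrete_inner S (discrete_orthopoly S k) (discrete_orthopoly S k))
      (discrete_orthopoly S k)"

lemma coeff_discrete_orthopoly:
  "coeff (discrete_orthopoly S k) k = 1 \<and> (\<forall>i>k. coeff (discrete_orthopoly S k) i = 0)"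
proof (induction S k rule: discrete_orthopoly.induct)
  case (3 S k)
  then show ?case by (auto simp: coeff_pCons split: nat.splits)
qed (auto simp: coeff_pCons split: nat.splits)

lemma discrete_orthopoly_parity:
  "poly (discrete_orthopoly S k) (- x) = (- 1) ^ k * poly (discrete_orthopoly S k) x"
  by (induction S k rule: discrete_orthopoly.induct) (auto simp: algebra_simps)

locale symmetric_support =
  fixes S :: "real set"
  assumes finite_S: "finite S" and symmetric: "x \<in> S \<Longrightarrow> - x \<in> S"
begin

abbreviation "P \<equiv> discrete_orthopoly S"

abbreviation "ip \<equiv> discrete_inner S"

lemma ip_simps:
  "ip (p - p') q = ip p q - ip p' q" "ip p (q - q') = ip p q - ip p q'"
  "ip (Polynomial.smult c p) q = c * ip p q" "ip p (Polynomial.smult c q) = c * ip p q"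
  "ip ([:0, 1:] * p) q = ip p ([:0, 1:] * q)"
  by (simp_all add: discrete_inner_def left_diff_distrib right_diff_distrib sum_subtractf
      sum_distrib_left mult_ac)

lemma sum_odd:
  assumes "\<And>x. h (- x) = - h x"
  shows "(\<Sum>x\<in>S. h x) = (0 :: real)"
proof -
  have "(\<Sum>x\<in>S. h x) = (\<Sum>x\<in>S. h (- x))"
    by (rule sum.reindex_bij_witness[of _ uminus uminus]) (auto simp: symmetric)
  also have "\<dots> = - (\<Sum>x\<in>S. h x)" by (simp add: assms sum_negf)
  finally show ?thesis by simp
qed

lemma ip_shift: "ip ([:0, 1:] * P k) (P k) = 0"
  unfolding discrete_inner_def
  by (rule sum_odd) (simp add: discrete_orthopoly_parity mult_ac flip: power_add)

text \<open>
  A nonzero polynomial of degree less than \<open>card S\<close> cannot vanish on all of \<open>S\<close>. So the recurrence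
  divides by nonzero numbers as long as it computes \<open>P\<close> up to index \<open>card S\<close>.
\<close>

lemma ip_pos:
  assumes "k < card S"
  shows "ip (P k) (P k) > 0"
proof -
  have nz: "P k \<noteq> 0" using coeff_discrete_orthopoly[of S k] by auto
  have "degree (P k) \<le> k" using coeff_discrete_orthopoly[of S k] by (intro degree_le) auto
  have "\<exists>x\<in>S. poly (P k) x \<noteq> 0"
  proof (rule ccontr)
    assume "\<not> (\<exists>x\<in>S. poly (P k) x \<noteq> 0)"
    then have "S \<subseteq> {x. poly (P k) x = 0}" by auto
    then have "card S \<le> card {x. poly (P k) x = 0}"
      by (intro card_mono poly_roots_finite nz)
    also have "\<dots> \<le> degree (P k)" by (rule card_poly_roots_bound[OF nz])
    finally show False using assms \<open>degree (P k) \<le> k\<close> by simp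
  qed
  then show ?thesis
    using finite_S by (auto simp: discrete_inner_def zero_less_mult_iff intro!: sum_pos2)
qed

lemma ip_top:
  assumes orth: "\<And>r. (\<And>i. i \<ge> k \<Longrightarrow> coeff r i = 0) \<Longrightarrow> ip (P k) r = 0"
    and q: "\<And>i. i > k \<Longrightarrow> coeff q i = 0"
  shows "ip (P k) q = coeff q k * ip (P k) (P k)"
proof -
  have "ip (P k) (q - Polynomial.smult (coeff q k) (P k)) = 0"
    using coeff_discrete_orthopoly[of S k] q by (intro orth) (auto simp: le_less)
  then show ?thesis by (simp add: ip_simps)
qed

text \<open>
  Split \<open>q\<close> into a multiple of \<open>P (k - 1)\<close> and a remainder \<open>r\<close> of lower degree. That \<open>P k\<close> is
  orthogonal to \<open>P (k - 1)\<close> is where the symmetry of \<open>S\<close> enters, through \<open>ip_shift\<close>. For \<open>r\<close>, the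
  product \<open>\<langle>X P (k - 1), r\<rangle> = \<langle>P (k - 1), X r\<rangle>\<close> only sees the coefficient of \<open>r\<close> at \<open>k - 2\<close>, and the
  recurrence coefficient is chosen to cancel it.
\<close>

lemma orthogonal:
  assumes "k \<le> card S" and "\<And>i. i \<ge> k \<Longrightarrow> coeff q i = 0"
  shows "ip (P k) q = 0"
  using assms
proof (induction k arbitrary: q rule: less_induct)
  case (less k)
  consider "k = 0" | "k = Suc 0" | m where "k = Suc (Suc m)" by (metis not0_implies_Suc)
  then show ?case
  proof cases
    case 1
    then have "q = 0" using less.prems by (intro poly_eqI) auto
    then show ?thesis by (simp add: discrete_inner_def)
  next
    case 2
    then have "q = [:coeff q 0:]"
      using less.prems by (intro poly_eqI) (auto simp: coeff_pCons split: nat.splits)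
    then obtain c where "q = [:c:]" by blast
    then have q: "poly q x = c" for x by simp
    then show ?thesis using 2 q sum_odd[of "\<lambda>x. x * c"] by (simp add: discrete_inner_def)
  next
    case 3
    let ?P1 = "P (Suc m)" and ?P0 = "P m"
    have orth0: "ip ?P0 r = 0" if "\<And>i. i \<ge> m \<Longrightarrow> coeff r i = 0" for r
      using that 3 less by simp
    have orth1: "ip ?P1 r = 0" if "\<And>i. i \<ge> Suc m \<Longrightarrow> coeff r i = 0" for r
      using that 3 less by simp
    define r where "r = q - Polynomial.smult (coeff q (Suc m)) ?P1"
    have r: "coeff r i = 0" if "i \<ge> Suc m" for i
      using that less.prems(2)[of i] coeff_discrete_orthopoly[of S "Suc m"] 3
      by (cases "i = Suc m") (auto simp: r_def)
    have pos: "ip ?P0 ?P0 > 0" using 3 less.prems(1) by (intro ip_pos) auto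
    have "ip (P k) ?P1 = 0"
    proof -
      have "ip ?P1 ?P0 = 0"
        using coeff_discrete_orthopoly[of S m] by (intro orth1) auto
      then have "ip ?P0 ?P1 = 0" by (simp add: discrete_inner_def mult.commute)
      then show ?thesis using ip_shift[of "Suc m"] by (simp only: 3 discrete_orthopoly.simps(3) ip_simps(1,3))
    qed
    moreover have "ip (P k) r = 0"
    proof -
      have "ip ?P1 ([:0, 1:] * r) = coeff r m * ip ?P1 ?P1"
        using r by (subst ip_top[OF orth1]) (auto simp: coeff_pCons split: nat.splits)
      moreover have "ip ?P0 r = coeff r m * ip ?P0 ?P0"
        using r by (intro ip_top[OF orth0]) auto
      ultimately show ?thesis
        using pos by (simp only: 3 discrete_orthopoly.simps(3) ip_simps(1,3,5)) simp
    qed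
    moreover have "q = r + Polynomial.smult (coeff q (Suc m)) ?P1" by (simp add: r_def)
    ultimately show ?thesis
      using ip_simps(2)[of "P k" q "Polynomial.smult (coeff q (Suc m)) ?P1"]
      by (simp add: ip_simps(4) flip: r_def)
  qed
qed

text \<open>
  \<open>P (card S)\<close> is orthogonal to the Lagrange polynomial of every point of \<open>S\<close>. This is what cuts the
  infinite recurrence down to an eigenvalue equation of a finite matrix.
\<close>

lemma vanishes_on_support:
  assumes "y \<in> S"
  shows "poly (P (card S)) y = 0"
proof -
  define q where "q = (\<Prod>z\<in>S - {y}. [:- z, 1:])"
  have "degree q = card (S - {y})"
    by (simp add: q_def degree_prod_eq_sum_degree del: card_Diff_insert card_Diff_singleton)
  then have deg: "degree q < card S" using card_Diff1_less[OF finite_S assms] by metis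
  have q: "poly q x = 0 \<longleftrightarrow> x \<in> S - {y}" for x
    using finite_S by (auto simp: q_def poly_prod prod_zero_iff)
  have "ip (P (card S)) q = 0"
    using deg by (intro orthogonal) (auto intro: coeff_eq_0)
  moreover have "ip (P (card S)) q = poly (P (card S)) y * poly q y"
  proof -
    have "(\<Sum>x\<in>S - {y}. poly (P (card S)) x * poly q x) = 0"
      by (rule sum.neutral) (simp add: q)
    then show ?thesis using assms finite_S by (simp add: discrete_inner_def sum.remove[of S y])
  qed
  ultimately show ?thesis using q[of y] by auto
qed

lemma three_term:
  "x * poly (P i) x = poly (P (Suc i)) x +
    (if i = 0 then 0 else ip (P i) (P i) / ip (P (i - 1)) (P (i - 1)) * poly (P (i - 1)) x)"
  by (cases i) (simp_all add: discrete_orthopoly.simps(3))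

end

text \<open>
  \<open>u\<close> is an eigenvector, for the eigenvalue \<open>x\<close>, of the symmetric tridiagonal \<open>n \<times> n\<close> matrix with zero
  diagonal and off-diagonal entries \<open>\<alpha> 0, \<dots>, \<alpha> (n - 2)\<close>, normalised at the first vertex; if these
  entries are nonzero, no eigenvector vanishes there.
\<close>

definition path_eigenvector :: "nat \<Rightarrow> (nat \<Rightarrow> real) \<Rightarrow> real \<Rightarrow> (nat \<Rightarrow> real) \<Rightarrow> bool" where
  "path_eigenvector n \<alpha> x u \<longleftrightarrow> u 0 = 1 \<and>
    (\<forall>i<n. x * u i =
      (if Suc i < n then \<alpha> i * u (Suc i) else 0) + (if i = 0 then 0 else \<alpha> (i - 1) * u (i - 1)))"

text \<open>
  Passing from the monic to the orthonormal polynomials symmetrises the recurrence. The factor \<open>s 0\<close>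
  only serves to normalise \<open>u x 0\<close>.
\<close>

theorem weighted_path_with_spectrum:
  fixes S :: "real set"
  assumes "finite S" and "\<And>x. x \<in> S \<Longrightarrow> - x \<in> S"
  shows "\<exists>\<alpha> u. (\<forall>i. Suc i < card S \<longrightarrow> \<alpha> i > 0) \<and>
    (\<forall>x\<in>S. path_eigenvector (card S) \<alpha> x (u x))"
proof -
  interpret symmetric_support S using assms by unfold_locales
  define s where "s i = sqrt (ip (P i) (P i))" for i
  have s: "s i > 0" "ip (P i) (P i) = (s i)\<^sup>2" if "i < card S" for i
    using ip_pos[OF that] by (simp_all add: s_def)
  define \<alpha> where "\<alpha> i = s (Suc i) / s i" for i
  define u where "u x i = poly (P i) x * s 0 / s i" for x i
  have pos: "\<alpha> i > 0" if "Suc i < card S" for i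
    using that s(1)[of i] s(1)[of "Suc i"] by (simp add: \<alpha>_def)
  have "path_eigenvector (card S) \<alpha> x (u x)" if x: "x \<in> S" for x
    unfolding path_eigenvector_def
  proof (intro conjI allI impI)
    have "card S > 0" using x finite_S by (auto simp: card_gt_0_iff)
    then show "u x 0 = 1" using s(1)[of 0] by (simp add: u_def)
    fix i assume i: "i < card S"
    have up: "poly (P (Suc i)) x * s 0 / s i = (if Suc i < card S then \<alpha> i * u x (Suc i) else 0)"
    proof (cases "Suc i < card S")
      case True
      then show ?thesis using s(1)[of "Suc i"] by (simp add: \<alpha>_def u_def)
    next
      case False
      then have "Suc i = card S" using i by simp
      then show ?thesis using vanishes_on_support[OF x] by simp
    qed
    have down: "ip (P i) (P i) / ip (P (i - 1)) (P (i - 1)) * poly (P (i - 1)) x * s 0 / s i =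
      \<alpha> (i - 1) * u x (i - 1)" if "i \<noteq> 0"
    proof -
      have "i - 1 < card S" using i by simp
      then show ?thesis
        using that s[of i] s[of "i - 1"] i
        by (simp add: \<alpha>_def u_def field_simps power2_eq_square)
    qed
    have "x * u x i = x * poly (P i) x * s 0 / s i" by (simp add: u_def)
    also have "\<dots> = (if Suc i < card S then \<alpha> i * u x (Suc i) else 0) +
      (if i = 0 then 0 else \<alpha> (i - 1) * u x (i - 1))"
      unfolding three_term up[symmetric] using down
      by (auto simp: add_divide_distrib distrib_right)
    finally show "x * u x i = (if Suc i < card S then \<alpha> i * u x (Suc i) else 0) +
      (if i = 0 then 0 else \<alpha> (i - 1) * u x (i - 1))" .
  qed
  with pos show ?thesis by blast
qed

text \<open>
  A linear relation between the eigenvectors may be multiplied by their eigenvalues, hence by any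
  polynomial in them. The polynomial vanishing at all eigenvalues but \<open>y\<close> isolates the coefficient of
  \<open>y\<close>, and it is read off at the first vertex.
\<close>

lemma path_eigenvectors_independent:
  fixes u :: "real \<Rightarrow> nat \<Rightarrow> real"
  assumes fin: "finite \<Lambda>" and n: "n > 0"
    and eigenvector: "\<And>x. x \<in> \<Lambda> \<Longrightarrow> path_eigenvector n \<alpha> x (u x)"
    and zero: "\<And>i. i < n \<Longrightarrow> (\<Sum>x\<in>\<Lambda>. c x * u x i) = 0"
    and y: "y \<in> \<Lambda>"
  shows "c y = 0"
proof -
  have first: "u x 0 = 1" if "x \<in> \<Lambda>" for x
    using eigenvector[OF that] by (simp add: path_eigenvector_def)
  have eigen: "x * u x i = (if Suc i < n then \<alpha> i * u x (Suc i) else 0) +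
      (if i = 0 then 0 else \<alpha> (i - 1) * u x (i - 1))" if "x \<in> \<Lambda>" "i < n" for x i
    using eigenvector[OF that(1)] that(2) by (simp only: path_eigenvector_def)
  have poly: "(\<Sum>x\<in>\<Lambda>. c x * poly q x * u x i) = 0" if "i < n" for q i
    using that
  proof (induction q arbitrary: i)
    case 0
    then show ?case by simp
  next
    case (pCons d q)
    let ?T = "\<lambda>i. \<Sum>x\<in>\<Lambda>. c x * poly q x * u x i"
    have "(\<Sum>x\<in>\<Lambda>. c x * poly (pCons d q) x * u x i) =
      d * (\<Sum>x\<in>\<Lambda>. c x * u x i) + (\<Sum>x\<in>\<Lambda>. c x * poly q x * (x * u x i))"
      by (simp add: algebra_simps sum.distrib sum_distrib_left)
    also have "(\<Sum>x\<in>\<Lambda>. c x * poly q x * (x * u x i)) =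
      (\<Sum>x\<in>\<Lambda>. (if Suc i < n then \<alpha> i else 0) * (c x * poly q x * u x (Suc i)) +
        (if i = 0 then 0 else \<alpha> (i - 1)) * (c x * poly q x * u x (i - 1)))"
      using pCons.prems by (intro sum.cong) (auto simp: eigen algebra_simps)
    also have "\<dots> = (if Suc i < n then \<alpha> i else 0) * ?T (Suc i) +
        (if i = 0 then 0 else \<alpha> (i - 1)) * ?T (i - 1)"
      by (simp add: sum.distrib sum_distrib_left)
    also have "\<dots> = 0"
      using pCons.IH[of "Suc i"] pCons.IH[of "i - 1"] pCons.prems by auto
    finally show ?case using zero[OF pCons.prems] by simp
  qed
  define q where "q = (\<Prod>z\<in>\<Lambda> - {y}. [:- z, 1:])"
  have q: "poly q x = 0 \<longleftrightarrow> x \<in> \<Lambda> - {y}" for x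
    using fin by (auto simp: q_def poly_prod prod_zero_iff)
  have "0 = (\<Sum>x\<in>\<Lambda>. c x * poly q x)"
    using poly[of 0 q] n first by simp
  also have "\<dots> = c y * poly q y + (\<Sum>x\<in>\<Lambda> - {y}. c x * poly q x)"
    using fin y by (rule sum.remove)
  also have "(\<Sum>x\<in>\<Lambda> - {y}. c x * poly q x) = 0"
    by (rule sum.neutral) (simp add: q)
  finally show ?thesis using q[of y] by auto
qed

definition spread_spectrum :: "nat \<Rightarrow> real set" where
  "spread_spectrum n = of_int ` ({- int (n div 2)..int (n div 2)} - (if even n then {0} else {}))"

lemma spread_spectrum:
  "finite (spread_spectrum n)" "card (spread_spectrum n) = n"
  "x \<in> spread_spectrum n \<Longrightarrow> - x \<in> spread_spectrum n"
proof -
  have "card (spread_spectrum n) =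
    card ({- int (n div 2)..int (n div 2)} - (if even n then {0} else {}))"
    unfolding spread_spectrum_def by (rule card_image) (auto simp: inj_on_def)
  then show "card (spread_spectrum n) = n"
    by (auto simp: card_Diff_singleton elim!: evenE oddE)
  show "finite (spread_spectrum n)" by (simp add: spread_spectrum_def)
  assume "x \<in> spread_spectrum n"
  then obtain k where k: "x = of_int k" "k \<in> {- int (n div 2)..int (n div 2)} - (if even n then {0} else {})"
    by (auto simp: spread_spectrum_def)
  then have "- x = of_int (- k)" "- k \<in> {- int (n div 2)..int (n div 2)} - (if even n then {0} else {})"
    by auto
  then show "- x \<in> spread_spectrum n" unfolding spread_spectrum_def by blast
qed

text \<open>
  For \<open>a \<le> b\<close>, every nonzero element of \<open>spread_spectrum a\<close> lies in \<open>spread_spectrum b\<close>. The number \<open>0\<close>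
  is in the first set only for odd \<open>a\<close>, and then missing in the second exactly if \<open>b\<close> is even.
\<close>

lemma card_common_spectrum:
  assumes "a \<le> b"
  shows "s_grid a b \<le> card (spread_spectrum a \<inter> spread_spectrum b)"
proof -
  have half: "int (a div 2) \<le> int (b div 2)" using assms by (simp add: div_le_mono)
  show ?thesis
  proof (cases "odd a \<and> even b")
    case True
    then have "spread_spectrum a - {0} \<subseteq> spread_spectrum a \<inter> spread_spectrum b"
      using half by (auto simp: spread_spectrum_def)
    then have "card (spread_spectrum a - {0}) \<le> card (spread_spectrum a \<inter> spread_spectrum b)"
      by (intro card_mono) (simp_all add: spread_spectrum)
    moreover have "card (spread_spectrum a - {0}) \<ge> a - 1"
      using diff_card_le_card_Diff[of "{0}" "spread_spectrum a"] by (simp add: spread_spectrum)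
    ultimately show ?thesis using True by (simp add: s_grid_def)
  next
    case False
    then have "spread_spectrum a \<subseteq> spread_spectrum b"
      using half by (auto simp: spread_spectrum_def split: if_splits)
    then show ?thesis by (simp add: s_grid_def Int_absorb2 spread_spectrum)
  qed
qed

section \<open>Skew-symmetric matrices of the grid\<close>

abbreviation grid :: "nat \<Rightarrow> nat \<Rightarrow> (nat \<times> nat) pair_pre_digraph" where
  "grid a b \<equiv> path_graph a \<box> path_graph b"

lemma pverts_grid: "pverts (grid a b) = {1..a} \<times> {1..b}"
  by (simp add: cartesian_product_def path_graph_def)

lemma parcs_grid: "((i, j), (i', j')) \<in> parcs (grid a b) \<longleftrightarrow>
  i \<in> {1..a} \<and> i' \<in> {1..a} \<and> j \<in> {1..b} \<and> j' \<in> {1..b} \<and>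
  (i = i' \<and> (j' = j + 1 \<or> j = j' + 1) \<or> j = j' \<and> (i' = i + 1 \<or> i = i' + 1))"
  by (auto simp: cartesian_product_def path_graph_def)

lemma card_pverts_grid: "card (pverts (grid a b)) = a * b"
  by (simp add: pverts_grid)

lemma vertex_numbering_grid:
  "vertex_numbering f (grid a b) \<longleftrightarrow> bij_betw f {..<a * b} ({1..a} \<times> {1..b})"
  by (simp add: vertex_numbering_def pverts_grid)

text \<open>
  The entry for an edge from \<open>p\<close> in the direction of a larger coordinate. The two directions carry
  opposite signs so that the contributions of \<open>\<alpha>\<close> and \<open>\<beta>\<close> cancel in \<open>grid_kernel_vector\<close>.
\<close>

fun forward_weight :: "(nat \<Rightarrow> real) \<Rightarrow> (nat \<Rightarrow> real) \<Rightarrow> nat \<times> nat \<Rightarrow> nat \<times> nat \<Rightarrow> real" where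
  "forward_weight \<alpha> \<beta> (i, j) q =
    (if q = (i + 1, j) then \<alpha> (i - 1) else 0) - (if q = (i, j + 1) then \<beta> (j - 1) else 0)"

definition grid_weight :: "(nat \<Rightarrow> real) \<Rightarrow> (nat \<Rightarrow> real) \<Rightarrow> nat \<times> nat \<Rightarrow> nat \<times> nat \<Rightarrow> real" where
  "grid_weight \<alpha> \<beta> p q = forward_weight \<alpha> \<beta> p q - forward_weight \<alpha> \<beta> q p"

lemma grid_weight_nonzero_iff:
  assumes pV: "p \<in> {1..a} \<times> {1..b}" and qV: "q \<in> {1..a} \<times> {1..b}"
    and \<alpha>: "\<And>i. Suc i < a \<Longrightarrow> \<alpha> i > 0" and \<beta>: "\<And>j. Suc j < b \<Longrightarrow> \<beta> j > 0"
  shows "grid_weight \<alpha> \<beta> p q \<noteq> 0 \<longleftrightarrow> (p, q) \<in> parcs (grid a b)"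
proof -
  obtain i j i' j' where pq: "p = (i, j)" "q = (i', j')" by (metis prod.exhaust)
  have ij: "1 \<le> i" "i \<le> a" "1 \<le> j" "j \<le> b" "1 \<le> i'" "i' \<le> a" "1 \<le> j'" "j' \<le> b"
    using pV qV pq by auto
  consider (right) "i' = i + 1" "j' = j" | (up) "i' = i" "j' = j + 1"
    | (left) "i = i' + 1" "j = j'" | (down) "i = i'" "j = j' + 1"
    | (none) "\<not> (i' = i + 1 \<and> j' = j)" "\<not> (i' = i \<and> j' = j + 1)"
      "\<not> (i = i' + 1 \<and> j = j')" "\<not> (i = i' \<and> j = j' + 1)"
    by blast
  then show ?thesis
  proof cases
    case right
    then have "\<alpha> (i - 1) > 0" using ij by (intro \<alpha>) simp
    then show ?thesis using right ij unfolding pq parcs_grid by (simp add: grid_weight_def)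
  next
    case up
    then have "\<beta> (j - 1) > 0" using ij by (intro \<beta>) simp
    then show ?thesis using up ij unfolding pq parcs_grid by (simp add: grid_weight_def)
  next
    case left
    then have "\<alpha> (i' - 1) > 0" using ij by (intro \<alpha>) simp
    then show ?thesis using left ij unfolding pq parcs_grid by (simp add: grid_weight_def)
  next
    case down
    then have "\<beta> (j' - 1) > 0" using ij by (intro \<beta>) simp
    then show ?thesis using down ij unfolding pq parcs_grid by (simp add: grid_weight_def)
  next
    case none
    then have "forward_weight \<alpha> \<beta> p q = 0" "forward_weight \<alpha> \<beta> q p = 0" by (auto simp: pq)
    moreover have "(p, q) \<notin> parcs (grid a b)" using none unfolding pq parcs_grid by blast
    ultimately show ?thesis by (simp add: grid_weight_def)
  qed
qed

text \<open>
  The sequence \<open>+, +, -, -, \<dots>\<close> is \<open>Re (\<i> ^ n) + Im (\<i> ^ n)\<close>. Conjugation by the diagonal matrix with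
  entries \<open>\<i> ^ n\<close> turns a skew-symmetric weighted path into \<open>\<i>\<close> times the symmetric one, and kernel
  vectors acquire the factors \<open>\<i> ^ n\<close>; the real and imaginary parts of a kernel vector of a real matrix
  are kernel vectors, and their sum has no zero entry where the original has none.
\<close>

definition quarter_sign :: "nat \<Rightarrow> real" where
  "quarter_sign n = (if n mod 4 < 2 then 1 else - 1)"

lemma quarter_sign_add_2: "quarter_sign (n + 2) = - quarter_sign n"
proof -
  have "(n + 2) mod 4 < 2 \<longleftrightarrow> \<not> n mod 4 < 2" by presburger
  then show ?thesis by (simp add: quarter_sign_def)
qed

text \<open>
  Neighbours of \<open>p\<close> with a larger coordinate carry the sign \<open>\<epsilon>\<close> and those with a smaller one carry
  \<open>- \<epsilon>\<close>, which undoes the minus sign of skew-symmetry. By the two eigenvalue equations, the row of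
  \<open>p = (i + 1, j + 1)\<close> then sums to \<open>\<epsilon> * (x * u i) * w j - \<epsilon> * u i * (x * w j)\<close>.
\<close>

lemma grid_kernel_vector:
  fixes \<alpha> \<beta> u w :: "nat \<Rightarrow> real"
  assumes u: "path_eigenvector a \<alpha> x u" and w: "path_eigenvector b \<beta> x w"
    and p: "p \<in> {1..a} \<times> {1..b}"
  shows "(\<Sum>q\<in>{1..a} \<times> {1..b}. grid_weight \<alpha> \<beta> p q *
    (quarter_sign (fst q + snd q) * u (fst q - 1) * w (snd q - 1))) = 0"
proof -
  let ?V = "{1..a} \<times> {1..b}"
  have eigen_u: "x * u i = (if Suc i < a then \<alpha> i * u (Suc i) else 0) +
      (if i = 0 then 0 else \<alpha> (i - 1) * u (i - 1))" if "i < a" for i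
    using u that by (simp only: path_eigenvector_def)
  have eigen_w: "x * w j = (if Suc j < b then \<beta> j * w (Suc j) else 0) +
      (if j = 0 then 0 else \<beta> (j - 1) * w (j - 1))" if "j < b" for j
    using w that by (simp only: path_eigenvector_def)
  define z where "z q = quarter_sign (fst q + snd q) * u (fst q - 1) * w (snd q - 1)" for q :: "nat \<times> nat"
  obtain i j where ij: "p = (Suc i, Suc j)" "i < a" "j < b"
    using p by (cases p) (auto simp: Suc_le_eq gr0_conv_Suc)
  define \<epsilon> where "\<epsilon> = quarter_sign (Suc (Suc (Suc (i + j))))"
  have \<epsilon>: "quarter_sign (Suc (i + j)) = - \<epsilon>"
    using quarter_sign_add_2[of "Suc (i + j)"] by (simp add: \<epsilon>_def)
  have z: "z (Suc (Suc i), Suc j) = \<epsilon> * u (Suc i) * w j"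
    "z (Suc i, Suc (Suc j)) = \<epsilon> * u i * w (Suc j)"
    "i \<noteq> 0 \<Longrightarrow> z (i, Suc j) = - \<epsilon> * u (i - 1) * w j"
    "j \<noteq> 0 \<Longrightarrow> z (Suc i, j) = - \<epsilon> * u i * w (j - 1)"
    using \<epsilon> by (simp_all add: z_def \<epsilon>_def)
  have t: "(if Suc i < a then \<alpha> i * z (Suc (Suc i), Suc j) else 0) =
      \<epsilon> * w j * (if Suc i < a then \<alpha> i * u (Suc i) else 0)"
    "(if Suc j < b then \<beta> j * z (Suc i, Suc (Suc j)) else 0) =
      \<epsilon> * u i * (if Suc j < b then \<beta> j * w (Suc j) else 0)"
    "(if i = 0 then 0 else \<alpha> (i - 1) * z (i, Suc j)) =
      - (\<epsilon> * w j * (if i = 0 then 0 else \<alpha> (i - 1) * u (i - 1)))"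
    "(if j = 0 then 0 else \<beta> (j - 1) * z (Suc i, j)) =
      - (\<epsilon> * u i * (if j = 0 then 0 else \<beta> (j - 1) * w (j - 1)))"
    using z by simp_all
  have "(\<Sum>q\<in>?V. grid_weight \<alpha> \<beta> p q * z q) =
    (\<Sum>q\<in>?V. if q = (Suc (Suc i), Suc j) then \<alpha> i * z q else 0) -
    (\<Sum>q\<in>?V. if q = (i, Suc j) then \<alpha> (i - 1) * z q else 0) -
    (\<Sum>q\<in>?V. if q = (Suc i, Suc (Suc j)) then \<beta> j * z q else 0) +
    (\<Sum>q\<in>?V. if q = (Suc i, j) then \<beta> (j - 1) * z q else 0)"
    unfolding sum.distrib[symmetric] sum_subtractf[symmetric]
  proof (intro sum.cong refl)
    fix q :: "nat \<times> nat"
    obtain i' j' where q: "q = (i', j')" by (cases q)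
    have bwd: "forward_weight \<alpha> \<beta> q p =
      (if q = (i, Suc j) then \<alpha> (i - 1) else 0) - (if q = (Suc i, j) then \<beta> (j - 1) else 0)"
      by (auto simp: q ij)
    show "grid_weight \<alpha> \<beta> p q * z q =
      (if q = (Suc (Suc i), Suc j) then \<alpha> i * z q else 0) -
      (if q = (i, Suc j) then \<alpha> (i - 1) * z q else 0) -
      (if q = (Suc i, Suc (Suc j)) then \<beta> j * z q else 0) +
      (if q = (Suc i, j) then \<beta> (j - 1) * z q else 0)"
      unfolding grid_weight_def bwd by (simp add: ij left_diff_distrib)
  qed
  also have "\<dots> = (if Suc i < a then \<alpha> i * z (Suc (Suc i), Suc j) else 0) -
    (if i = 0 then 0 else \<alpha> (i - 1) * z (i, Suc j)) -
    (if Suc j < b then \<beta> j * z (Suc i, Suc (Suc j)) else 0) +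
    (if j = 0 then 0 else \<beta> (j - 1) * z (Suc i, j))"
    using ij by (simp add: sum.delta Suc_le_eq)
  also have "\<dots> = \<epsilon> * w j * ((if Suc i < a then \<alpha> i * u (Suc i) else 0) +
      (if i = 0 then 0 else \<alpha> (i - 1) * u (i - 1))) -
    \<epsilon> * u i * ((if Suc j < b then \<beta> j * w (Suc j) else 0) +
      (if j = 0 then 0 else \<beta> (j - 1) * w (j - 1)))"
    unfolding t by (simp only: distrib_left)
  also have "\<dots> = 0"
    unfolding eigen_u[OF ij(2), symmetric] eigen_w[OF ij(3), symmetric] by (simp add: mult_ac)
  finally show ?thesis by (simp add: z_def)
qed

section \<open>The upper bound\<close>

text \<open>
  The equation at \<open>(i, j - 1)\<close> forces the value at \<open>(i, j)\<close>, so the equations used are those outside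
  the last column.
\<close>

lemma determined_by_first_column:
  fixes g :: "nat \<times> nat \<Rightarrow> nat \<times> nat \<Rightarrow> real"
  assumes pattern: "\<And>p q. p \<in> {1..a} \<times> {1..b} \<Longrightarrow> q \<in> {1..a} \<times> {1..b} \<Longrightarrow>
      g p q \<noteq> 0 \<longleftrightarrow> (p, q) \<in> parcs (grid a b)"
    and row: "\<And>p. p \<in> {1..a} \<times> {1..b} \<Longrightarrow> snd p < b \<Longrightarrow> (\<Sum>q\<in>{1..a} \<times> {1..b}. g p q * x q) = 0"
    and first: "\<And>i. i \<in> {1..a} \<Longrightarrow> x (i, 1) = 0"
    and q: "q \<in> {1..a} \<times> {1..b}"
  shows "x q = 0"
proof (rule zero_forcing[where V = "{1..a} \<times> {1..b}" and g = g and P = "\<lambda>p. snd p < b"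
      and level = "\<lambda>q. snd q - 1"])
  fix q :: "nat \<times> nat"
  assume q: "q \<in> {1..a} \<times> {1..b}" and pos: "snd q - 1 > 0"
  obtain i j where ij: "q = (i, j)" by (cases q)
  have "(i, j - 1) \<in> {1..a} \<times> {1..b}" using q pos by (auto simp: ij)
  moreover have "g (i, j - 1) q \<noteq> 0"
    using q pos calculation by (subst pattern) (auto simp: ij parcs_grid)
  moreover have "snd r - 1 < snd q - 1"
    if "r \<in> {1..a} \<times> {1..b}" "r \<noteq> q" "g (i, j - 1) r \<noteq> 0" for r
  proof -
    have "((i, j - 1), (fst r, snd r)) \<in> parcs (grid a b)" using pattern that calculation by simp
    then show ?thesis using that(2) pos by (cases r) (auto simp: parcs_grid ij)
  qed
  ultimately show "\<exists>p\<in>{1..a} \<times> {1..b}. snd p < b \<and> g p q \<noteq> 0 \<and>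
      (\<forall>r\<in>{1..a} \<times> {1..b}. r \<noteq> q \<longrightarrow> g p r \<noteq> 0 \<longrightarrow> snd r - 1 < snd q - 1)"
    using q pos by (intro bexI[of _ "(i, j - 1)"]) (auto simp: ij)
next
  fix q :: "nat \<times> nat"
  assume "q \<in> {1..a} \<times> {1..b}" and "snd q - 1 = 0"
  then show "x q = 0" using first by (cases q) (auto simp: le_Suc_eq)
qed (use row q in auto)

lemma determined_by_last_column:
  fixes g :: "nat \<times> nat \<Rightarrow> nat \<times> nat \<Rightarrow> real"
  assumes pattern: "\<And>p q. p \<in> {1..a} \<times> {1..b} \<Longrightarrow> q \<in> {1..a} \<times> {1..b} \<Longrightarrow>
      g p q \<noteq> 0 \<longleftrightarrow> (p, q) \<in> parcs (grid a b)"
    and row: "\<And>p. p \<in> {1..a} \<times> {1..b} \<Longrightarrow> (\<Sum>q\<in>{1..a} \<times> {1..b}. g p q * x q) = 0"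
    and last: "\<And>i. i \<in> {1..a} \<Longrightarrow> x (i, b) = 0"
    and q: "q \<in> {1..a} \<times> {1..b}"
  shows "x q = 0"
proof (rule zero_forcing[where V = "{1..a} \<times> {1..b}" and g = g and P = "\<lambda>p. True"
      and level = "\<lambda>q. b - snd q"])
  fix q :: "nat \<times> nat"
  assume q: "q \<in> {1..a} \<times> {1..b}" and pos: "b - snd q > 0"
  obtain i j where ij: "q = (i, j)" by (cases q)
  have "(i, j + 1) \<in> {1..a} \<times> {1..b}" using q pos by (auto simp: ij)
  moreover have "g (i, j + 1) q \<noteq> 0"
    using q pos calculation by (subst pattern) (auto simp: ij parcs_grid)
  moreover have "b - snd r < b - snd q"
    if "r \<in> {1..a} \<times> {1..b}" "r \<noteq> q" "g (i, j + 1) r \<noteq> 0" for r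
  proof -
    have "((i, j + 1), (fst r, snd r)) \<in> parcs (grid a b)" using pattern that calculation by simp
    then show ?thesis using that(2) pos by (cases r) (auto simp: parcs_grid ij)
  qed
  ultimately show "\<exists>p\<in>{1..a} \<times> {1..b}. True \<and> g p q \<noteq> 0 \<and>
      (\<forall>r\<in>{1..a} \<times> {1..b}. r \<noteq> q \<longrightarrow> g p r \<noteq> 0 \<longrightarrow> b - snd r < b - snd q)"
    by (intro bexI[of _ "(i, j + 1)"]) auto
next
  fix q :: "nat \<times> nat"
  assume "q \<in> {1..a} \<times> {1..b}" and "b - snd q = 0"
  then show "x q = 0" using last by (cases q) auto
qed (use row q in auto)

text \<open>
  The bound counts the vectors that satisfy the equations outside the last column, a space that may be
  larger than the kernel; the parity argument in \<open>no_null_family_odd_even\<close> compares the two.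
\<close>

lemma card_null_family_le:
  fixes g :: "nat \<times> nat \<Rightarrow> nat \<times> nat \<Rightarrow> real"
  assumes b: "b \<ge> 1"
    and pattern: "\<And>p q. p \<in> {1..a} \<times> {1..b} \<Longrightarrow> q \<in> {1..a} \<times> {1..b} \<Longrightarrow>
      g p q \<noteq> 0 \<longleftrightarrow> (p, q) \<in> parcs (grid a b)"
    and row: "\<And>l p. l < k \<Longrightarrow> p \<in> {1..a} \<times> {1..b} \<Longrightarrow> snd p < b \<Longrightarrow>
      (\<Sum>q\<in>{1..a} \<times> {1..b}. g p q * w l q) = 0"
    and indep: "independent_on ({1..a} \<times> {1..b}) k w"
  shows "k \<le> a"
proof -
  have "k \<le> card ({1..a} \<times> {1::nat})"
  proof (rule independent_card_le[OF _ _ indep])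
    fix c assume zero: "\<And>p. p \<in> {1..a} \<times> {1} \<Longrightarrow> (\<Sum>l<k. c l * w l p) = 0"
    show "\<forall>p\<in>{1..a} \<times> {1..b}. (\<Sum>l<k. c l * w l p) = 0"
    proof
      fix q assume q: "q \<in> {1..a} \<times> {1..b}"
      show "(\<Sum>l<k. c l * w l q) = 0"
      proof (rule determined_by_first_column[OF pattern _ _ q])
        fix p assume p: "p \<in> {1..a} \<times> {1..b}" "snd p < b"
        have "(\<Sum>q\<in>{1..a} \<times> {1..b}. g p q * (\<Sum>l<k. c l * w l q)) =
          (\<Sum>l<k. c l * (\<Sum>q\<in>{1..a} \<times> {1..b}. g p q * w l q))"
          unfolding sum_distrib_left by (subst sum.swap) (simp add: mult_ac)
        also have "\<dots> = 0" using row p by simp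
        finally show "(\<Sum>q\<in>{1..a} \<times> {1..b}. g p q * (\<Sum>l<k. c l * w l q)) = 0" .
      qed (use zero in auto)
    qed
  qed (use b in auto)
  then show ?thesis by simp
qed

text \<open>
  A null vector \<open>x\<close> of the principal submatrix on the first \<open>b - 1\<close> columns, extended by \<open>0\<close> to \<open>y\<close>,
  satisfies all equations outside the last column. If it violated one in the last column, it
  could be added to \<open>w\<close> to give \<open>a + 1\<close> independent vectors of this kind, which is one too many.
  So \<open>y\<close> is a kernel vector with last column \<open>0\<close>, that is, \<open>y = 0\<close>.
\<close>

lemma no_null_family_odd_even:
  fixes g :: "nat \<times> nat \<Rightarrow> nat \<times> nat \<Rightarrow> real"
  assumes "odd a" and "even b" and b: "b \<ge> 1"
    and pattern: "\<And>p q. p \<in> {1..a} \<times> {1..b} \<Longrightarrow> q \<in> {1..a} \<times> {1..b} \<Longrightarrow>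
      g p q \<noteq> 0 \<longleftrightarrow> (p, q) \<in> parcs (grid a b)"
    and skew: "\<And>p q. p \<in> {1..a} \<times> {1..b} \<Longrightarrow> q \<in> {1..a} \<times> {1..b} \<Longrightarrow> g q p = - g p q"
    and row: "\<And>l p. l < a \<Longrightarrow> p \<in> {1..a} \<times> {1..b} \<Longrightarrow>
      (\<Sum>q\<in>{1..a} \<times> {1..b}. g p q * w l q) = 0"
    and indep: "independent_on ({1..a} \<times> {1..b}) a w"
  shows False
proof -
  let ?V = "{1..a} \<times> {1..b}"
  define R where "R = {1..a} \<times> {1..b - 1}"
  have RV: "R \<subseteq> ?V" by (auto simp: R_def)
  have "odd (card R)" using assms(1-3) by (simp add: R_def)
  then obtain x where x: "\<exists>p\<in>R. x p \<noteq> 0" "\<And>p. p \<in> R \<Longrightarrow> (\<Sum>q\<in>R. g p q * x q) = 0"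
    using odd_skew_singular[of R g] skew RV by blast
  define y where "y q = (if q \<in> R then x q else 0)" for q
  have y_row: "(\<Sum>q\<in>?V. g p q * y q) = 0" if "p \<in> ?V" "snd p < b" for p
  proof -
    have "(\<Sum>q\<in>?V. g p q * y q) = (\<Sum>q\<in>R. g p q * x q)"
      using RV by (intro sum.mono_neutral_cong_right) (auto simp: y_def)
    then show ?thesis using x(2) that by (auto simp: R_def)
  qed
  have y_kernel: "(\<Sum>q\<in>?V. g p q * y q) = 0" if p: "p \<in> ?V" for p
  proof (rule ccontr)
    assume nz: "(\<Sum>q\<in>?V. g p q * y q) \<noteq> 0"
    have "Suc a \<le> a"
    proof (rule card_null_family_le[OF b pattern])
      fix l p assume "l < Suc a" "p \<in> ?V" "snd p < b"
      then show "(\<Sum>q\<in>?V. g p q * (w(a := y)) l q) = 0"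
        using row y_row by (cases "l = a") simp_all
    next
      show "independent_on ?V (Suc a) (w(a := y))"
        unfolding independent_on_def
      proof (intro allI impI)
        fix c l assume zero: "\<forall>p\<in>?V. (\<Sum>l<Suc a. c l * (w(a := y)) l p) = 0" and l: "l < Suc a"
        have c: "(\<Sum>l<a. c l * w l q) + c a * y q = 0" if "q \<in> ?V" for q
          using bspec[OF zero that] by simp
        have "0 = (\<Sum>q\<in>?V. g p q * ((\<Sum>l<a. c l * w l q) + c a * y q))"
          using c by simp
        also have "\<dots> = (\<Sum>l<a. c l * (\<Sum>q\<in>?V. g p q * w l q)) + c a * (\<Sum>q\<in>?V. g p q * y q)"
          unfolding distrib_left sum.distrib sum_distrib_left
          by (subst sum.swap) (simp add: mult_ac)
        also have "\<dots> = c a * (\<Sum>q\<in>?V. g p q * y q)" using row p by simp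
        finally have ca: "c a = 0" using nz by simp
        then have "\<forall>l<a. c l = 0" using c indep by (simp add: independent_on_def)
        then show "c l = 0" using ca l by (auto simp: less_Suc_eq)
      qed
    qed
    then show False by simp
  qed
  have last: "y (i, b) = 0" for i using b by (auto simp: y_def R_def)
  have "y q = 0" if "q \<in> ?V" for q
    by (rule determined_by_last_column[OF pattern y_kernel last that])
  then show False using x(1) RV y_def by (metis subsetD)
qed

lemma grid_nullity_le:
  assumes f: "vertex_numbering f (grid a b)" and A: "A \<in> S_minus f (grid a b)" and b: "b \<ge> 1"
  shows "kernel_dim A \<le> s_grid a b"
proof -
  let ?V = "{1..a} \<times> {1..b}" and ?n = "a * b"
  note card = card_pverts_grid[of a b]
  have bij: "bij_betw f {..<?n} ?V" using f by (simp only: vertex_numbering_grid)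
  have carrier: "A \<in> carrier_mat ?n ?n" and tr: "transpose_mat A = - A"
    and arcs: "\<And>i j. i < ?n \<Longrightarrow> j < ?n \<Longrightarrow> i \<noteq> j \<Longrightarrow> A $$ (i, j) \<noteq> 0 \<longleftrightarrow> (f i, f j) \<in> parcs (grid a b)"
    using A unfolding S_minus_def card by auto
  define ix where "ix = the_inv_into {..<?n} f"
  define g where "g p q = A $$ (ix p, ix q)" for p q
  have ix: "ix p < ?n" "f (ix p) = p" if "p \<in> ?V" for p
    using bij that the_inv_into_into[of f "{..<?n}" p "{..<?n}"] f_the_inv_into_f[of f "{..<?n}" p]
    by (auto simp: ix_def bij_betw_def)
  have ixf: "ix (f i) = i" if "i < ?n" for i
    using bij that by (simp add: ix_def bij_betw_def the_inv_into_f_f)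
  have skew_A: "A $$ (j, i) = - A $$ (i, j)" if "i < ?n" "j < ?n" for i j
    using arg_cong[OF tr, of "\<lambda>M. M $$ (i, j)"] carrier that by simp
  have skew: "g q p = - g p q" if "p \<in> ?V" "q \<in> ?V" for p q
    unfolding g_def using ix that by (intro skew_A)
  have pattern: "g p q \<noteq> 0 \<longleftrightarrow> (p, q) \<in> parcs (grid a b)" if "p \<in> ?V" "q \<in> ?V" for p q
  proof (cases "p = q")
    case True
    then have "g p q = 0" using skew[OF that] by simp
    moreover have "(p, q) \<notin> parcs (grid a b)" unfolding True by (cases q) (simp add: parcs_grid)
    ultimately show ?thesis by simp
  next
    case False
    then have "ix p \<noteq> ix q" using ix that by metis
    then show ?thesis using arcs[of "ix p" "ix q"] ix that by (simp add: g_def)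
  qed
  have "g (f i) (f j) = A $$ (i, j)" if "i < ?n" "j < ?n" for i j
    using ixf that by (simp add: g_def)
  from nullity_ge_iff[OF carrier bij this, THEN iffD1, OF _ _ order_refl]
  obtain w where w: "\<forall>l<kernel_dim A. \<forall>p\<in>?V. (\<Sum>q\<in>?V. g p q * w l q) = 0"
    "independent_on ?V (kernel_dim A) w" by blast
  have le: "kernel_dim A \<le> a"
    by (rule card_null_family_le[OF b pattern _ w(2)]) (use w(1) in auto)
  moreover have "kernel_dim A \<noteq> a" if "odd a" "even b"
    using no_null_family_odd_even[OF that b pattern skew, of w] w by auto
  ultimately show ?thesis by (cases "odd a \<and> even b") (auto simp: s_grid_def)
qed

section \<open>The lower bound and the theorem\<close>

text \<open>
  On the first column the \<open>P\<^sub>b\<close>-factor of every product vector is \<open>1\<close>, so a linear relation between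
  the products restricts to one between eigenvectors of the weighted \<open>P\<^sub>a\<close>.
\<close>

lemma grid_nullity_attained:
  assumes f: "vertex_numbering f (grid a b)" and ab: "1 \<le> a" "a \<le> b"
  obtains A where "A \<in> S_minus f (grid a b)" and "kernel_dim A \<ge> s_grid a b"
proof -
  let ?V = "{1..a} \<times> {1..b}" and ?n = "a * b"
  note card = card_pverts_grid[of a b]
  have bij: "bij_betw f {..<?n} ?V" using f by (simp only: vertex_numbering_grid)
  then have fV: "f i \<in> ?V" if "i < ?n" for i using that by (auto simp: bij_betw_def)
  obtain \<alpha> u where \<alpha>: "\<And>i. Suc i < a \<Longrightarrow> \<alpha> i > 0"
    and u: "\<And>x. x \<in> spread_spectrum a \<Longrightarrow> path_eigenvector a \<alpha> x (u x)"
    using weighted_path_with_spectrum[OF spread_spectrum(1,3), of a]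
    unfolding spread_spectrum(2) by blast
  obtain \<beta> v where \<beta>: "\<And>i. Suc i < b \<Longrightarrow> \<beta> i > 0"
    and v: "\<And>x. x \<in> spread_spectrum b \<Longrightarrow> path_eigenvector b \<beta> x (v x)"
    using weighted_path_with_spectrum[OF spread_spectrum(1,3), of b]
    unfolding spread_spectrum(2) by blast
  define A where "A = mat ?n ?n (\<lambda>(i, j). grid_weight \<alpha> \<beta> (f i) (f j))"
  have carrier: "A \<in> carrier_mat ?n ?n" by (simp add: A_def)
  have "transpose_mat A = - A"
    by (rule eq_matI) (auto simp: A_def grid_weight_def)
  then have A: "A \<in> S_minus f (grid a b)"
    using grid_weight_nonzero_iff[OF fV fV, of _ _ \<alpha> \<beta>] \<alpha> \<beta>
    unfolding S_minus_def card by (simp add: A_def)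
  define \<Lambda> where "\<Lambda> = spread_spectrum a \<inter> spread_spectrum b"
  have fin: "finite \<Lambda>" by (simp add: \<Lambda>_def spread_spectrum)
  obtain h where h: "bij_betw h {..<card \<Lambda>} \<Lambda>"
    using ex_bij_betw_nat_finite[OF fin] by (auto simp: atLeast0LessThan)
  have h\<Lambda>: "h l \<in> \<Lambda>" if "l < card \<Lambda>" for l using h that by (auto simp: bij_betw_def)
  define w where "w l q = quarter_sign (fst q + snd q) * u (h l) (fst q - 1) * v (h l) (snd q - 1)"
    for l and q :: "nat \<times> nat"
  have v0: "v (h l) 0 = 1" if "l < card \<Lambda>" for l
    using v h\<Lambda>[OF that] by (auto simp: path_eigenvector_def \<Lambda>_def)
  have kernel: "(\<Sum>q\<in>?V. grid_weight \<alpha> \<beta> p q * w l q) = 0" if "l < card \<Lambda>" "p \<in> ?V" for l p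
    unfolding w_def using h\<Lambda>[OF that(1)] that(2) u v
    by (intro grid_kernel_vector[where x = "h l"]) (auto simp: \<Lambda>_def)
  have indep: "independent_on ?V (card \<Lambda>) w"
    unfolding independent_on_def
  proof (intro allI impI)
    fix c l assume c: "\<forall>p\<in>?V. (\<Sum>l<card \<Lambda>. c l * w l p) = 0" and l: "l < card \<Lambda>"
    define d where "d x = c (the_inv_into {..<card \<Lambda>} h x)" for x
    have d: "d (h l) = c l" if "l < card \<Lambda>" for l
      using h that by (simp add: d_def bij_betw_def the_inv_into_f_f)
    have "(\<Sum>x\<in>\<Lambda>. d x * u x i) = 0" if "i < a" for i
    proof -
      have "(\<Sum>x\<in>\<Lambda>. d x * u x i) = (\<Sum>l<card \<Lambda>. c l * u (h l) i)"
        using sum.reindex_bij_betw[OF h, of "\<lambda>x. d x * u x i"] by (simp add: d)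
      moreover have "quarter_sign (i + 2) * (\<Sum>l<card \<Lambda>. c l * u (h l) i) = 0"
        using c[rule_format, of "(Suc i, 1)"] that ab
        by (simp add: w_def v0 sum_distrib_left mult_ac)
      moreover have "quarter_sign (i + 2) \<noteq> 0" by (simp add: quarter_sign_def)
      ultimately show ?thesis by simp
    qed
    then have "d (h l) = 0"
      using path_eigenvectors_independent[of \<Lambda> a \<alpha> u d "h l"] h\<Lambda>[OF l] u fin ab
      by (simp add: \<Lambda>_def)
    then show "c l = 0" using d l by simp
  qed
  have "card \<Lambda> \<le> kernel_dim A"
  proof (rule nullity_ge_iff[THEN iffD2, OF carrier bij])
    show "grid_weight \<alpha> \<beta> (f i) (f j) = A $$ (i, j)" if "i < ?n" "j < ?n" for i j
      using that by (simp add: A_def)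
  qed (use kernel indep in blast)
  then have "s_grid a b \<le> kernel_dim A"
    using card_common_spectrum[OF ab(2)] by (simp add: \<Lambda>_def)
  then show thesis using A that by blast
qed

theorem corollary4p2:
  fixes a b :: nat
    and f :: "nat \<Rightarrow> nat \<times> nat"
  assumes "2 \<le> a" and "a \<le> b"
    and "vertex_numbering f (path_graph a \<box> path_graph b)"
  shows "M_minus f (path_graph a \<box> path_graph b) = s_grid a b \<and>
    mr_minus f (path_graph a \<box> path_graph b) = a * b - s_grid a b"
proof
  have le: "kernel_dim A \<le> s_grid a b" if "A \<in> S_minus f (grid a b)" for A
    using grid_nullity_le[OF assms(3) that] assms(1,2) by simp
  obtain A where A: "A \<in> S_minus f (grid a b)" "kernel_dim A \<ge> s_grid a b"
    using grid_nullity_attained[OF assms(3) _ assms(2)] assms(1) by auto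
  then have nullity: "kernel_dim A = s_grid a b" using le by (simp add: le_antisym)
  have rank: "mat_rank B = a * b - kernel_dim B" if "B \<in> S_minus f (grid a b)" for B
    using rank_plus_nullity[of B "a * b" "a * b"] that by (simp add: S_minus_def pverts_grid)
  show "M_minus f (grid a b) = s_grid a b"
    unfolding M_minus_def
    by (rule Max_eqI) (use finite_nullities le A nullity in \<open>auto intro: image_eqI[of _ _ A]\<close>)
  show "mr_minus f (grid a b) = a * b - s_grid a b"
    unfolding mr_minus_def
  proof (rule Min_eqI)
    show "finite (mat_rank ` S_minus f (grid a b))" by (rule finite_ranks)
    show "a * b - s_grid a b \<in> mat_rank ` S_minus f (grid a b)"
      using rank[OF A(1)] A(1) nullity by (auto intro: image_eqI[of _ _ A])
  qed (use rank le in \<open>auto intro: diff_le_mono2\<close>)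
qed

end
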